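(* Let $S$ be an Arf numerical semigroup with multiplicity bigger than $3$, and let $\Bbbk$ be an algebraically closed field of characteristic zero. Then the defining ideal $I_S$ of $\Bbbk[S]$ is not generic.
   Context: A numerical semigroup is a subset $S\subseteq\mathbb{N}_0$ (non-negative integers) containing $0$, closed under addition, with finite complement in $\mathbb{N}_0$. Its multiplicity is its smallest nonzero element. $S$ is Arf if $s_2+s_3-s_1\in S$ for all $s_1\le s_2\le s_3$ in $S$. Let $n_1<\dots<n_e$ be the minimal generators of $S$. $\Bbbk[S]=\Bbbk[t^s\mid s\in S]\subseteq\Bbbk[t]$, and the defining ideal $I_S$ is the kernel of the surjective $\Bbbk$-algebra map $\Bbbk[x_1,\dots,x_e]\to\Bbbk[S]$, $x_i\mapsto t^{n_i}$. For $\mathbf{a}\in\mathbb{N}_0^e$, $\mathbf{x}^{\mathbf{a}}=x_1^{a_1}\cdots x_e^{a_e}$ and $\mathrm{Supp}\,\mathbf{a}=\{i\mid a_i\ne0\}$. A binomial $\phi=\mathbf{x}^{\mathbf{a}}-\mathbf{x}^{\mathbf{b}}$ has full support if $\mathrm{Supp}\,\mathbf{a}\cup\mathrm{Supp}\,\mathbf{b}=\{1,\dots,e\}$. $I_S$ is called generic if it has a minimal generating system consisting of binomials with full support. *)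

theory Defs
  imports
    "HOL-Library.Poly_Mapping"
    "HOL-Algebra.Algebraic_Closure_Type"
begin

section \<open>Numerical semigroups\<close>

definition numerical_semigroup :: "nat set \<Rightarrow> bool" where
  "numerical_semigroup S \<longleftrightarrow>
     0 \<in> S \<and> (\<forall>a\<in>S. \<forall>b\<in>S. a + b \<in> S) \<and> finite (UNIV - S)"

definition sg_multiplicity :: "nat set \<Rightarrow> nat" where
  "sg_multiplicity S = (LEAST s. s \<in> S \<and> s \<noteq> 0)"

definition arf :: "nat set \<Rightarrow> bool" where
  "arf S \<longleftrightarrow>
     (\<forall>s1\<in>S. \<forall>s2\<in>S. \<forall>s3\<in>S. s1 \<le> s2 \<longrightarrow> s2 \<le> s3 \<longrightarrow> s2 + s3 - s1 \<in> S)"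

inductive_set submonoid_gen :: "nat set \<Rightarrow> nat set" for A :: "nat set" where
  zero: "0 \<in> submonoid_gen A"
| gen: "a \<in> A \<Longrightarrow> a \<in> submonoid_gen A"
| add: "a \<in> submonoid_gen A \<Longrightarrow> b \<in> submonoid_gen A \<Longrightarrow> a + b \<in> submonoid_gen A"

definition minimal_sg_generators :: "nat set \<Rightarrow> nat set \<Rightarrow> bool" where
  "minimal_sg_generators S A \<longleftrightarrow>
     submonoid_gen A = S \<and> (\<forall>B. B \<subset> A \<longrightarrow> submonoid_gen B \<noteq> S)"

text \<open>
  For a numerical semigroup, the definite description below is justified by
  \<open>minimal_sg_generators_iff\<close>, which also identifies the minimal generators with
  the nonzero elements that are not sums of two nonzero elements.
\<close>

definition min_gens :: "nat set \<Rightarrow> nat set" where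
  "min_gens S = (THE A. minimal_sg_generators S A)"

definition embdim :: "nat set \<Rightarrow> nat" where
  "embdim S = card (min_gens S)"

text \<open>
  The generators are numbered \<open>n\<^sub>1 < \<dots> < n\<^sub>e\<close>, so \<open>mingen S i\<close> is meant for
  \<open>1 \<le> i \<le> embdim S\<close>.
\<close>

definition mingen :: "nat set \<Rightarrow> nat \<Rightarrow> nat" where
  "mingen S i = sorted_list_of_set (min_gens S) ! (i - 1)"

definition sg_atoms :: "nat set \<Rightarrow> nat set" where
  "sg_atoms S = {s \<in> S. s \<noteq> 0 \<and> \<not> (\<exists>a\<in>S. \<exists>b\<in>S. a \<noteq> 0 \<and> b \<noteq> 0 \<and> s = a + b)}"

lemma submonoid_gen_subset:
  assumes "numerical_semigroup S" "A \<subseteq> S"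
  shows "submonoid_gen A \<subseteq> S"
proof
  fix x assume "x \<in> submonoid_gen A"
  then show "x \<in> S"
    by induction (use assms in \<open>auto simp: numerical_semigroup_def\<close>)
qed

lemma submonoid_gen_atoms:
  assumes "numerical_semigroup S"
  shows "submonoid_gen (sg_atoms S) = S"
proof
  show "submonoid_gen (sg_atoms S) \<subseteq> S"
    by (rule submonoid_gen_subset[OF assms]) (auto simp: sg_atoms_def)
  show "S \<subseteq> submonoid_gen (sg_atoms S)"
  proof
    fix x assume "x \<in> S"
    then show "x \<in> submonoid_gen (sg_atoms S)"
    proof (induction x rule: less_induct)
      case (less x)
      show ?case
      proof (cases "x = 0 \<or> x \<in> sg_atoms S")
        case True
        then show ?thesis by (auto intro: submonoid_gen.intros)
      next
        case False
        then obtain a b where ab: "a \<in> S" "b \<in> S" "a \<noteq> 0" "b \<noteq> 0" "x = a + b"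
          using less.prems by (auto simp: sg_atoms_def)
        then have "a \<in> submonoid_gen (sg_atoms S)" "b \<in> submonoid_gen (sg_atoms S)"
          using less.IH by auto
        then show ?thesis using ab by (auto intro: submonoid_gen.add)
      qed
    qed
  qed
qed

lemma atoms_subset_generators: "sg_atoms (submonoid_gen A) \<subseteq> A"
proof
  fix x assume x: "x \<in> sg_atoms (submonoid_gen A)"
  have "y = 0 \<or> y \<in> A \<or> (\<exists>a\<in>submonoid_gen A. \<exists>b\<in>submonoid_gen A. a \<noteq> 0 \<and> b \<noteq> 0 \<and> y = a + b)"
    if "y \<in> submonoid_gen A" for y
    using that
  proof induction
    case (add a b)
    then show ?case by (cases "a = 0"; cases "b = 0") auto
  qed auto
  then show "x \<in> A" using x unfolding sg_atoms_def by blast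
qed

lemma minimal_sg_generators_iff:
  assumes "numerical_semigroup S"
  shows "minimal_sg_generators S A \<longleftrightarrow> A = sg_atoms S"
proof
  assume "minimal_sg_generators S A"
  then show "A = sg_atoms S"
    using submonoid_gen_atoms[OF assms] atoms_subset_generators[of A]
    unfolding minimal_sg_generators_def by blast
next
  assume "A = sg_atoms S"
  then show "minimal_sg_generators S A"
    using submonoid_gen_atoms[OF assms] atoms_subset_generators
    unfolding minimal_sg_generators_def by blast
qed

lemma min_gens_eq_atoms:
  assumes "numerical_semigroup S"
  shows "min_gens S = sg_atoms S"
  unfolding min_gens_def using minimal_sg_generators_iff[OF assms] by (intro the_equality) auto

lemma finite_min_gens:
  assumes "numerical_semigroup S"
  shows "finite (min_gens S)"
proof -
  have "infinite S"
    using assms finite_Diff2[of S UNIV] by (auto simp: numerical_semigroup_def)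
  then obtain m where m: "m \<in> S" "m \<noteq> 0"
    by (metis finite.emptyI finite_insert insertI1 subsetI finite_subset)
  have "sg_atoms S \<subseteq> {..m} \<union> (\<lambda>s. s + m) ` (UNIV - S)"
  proof
    fix s assume s: "s \<in> sg_atoms S"
    show "s \<in> {..m} \<union> (\<lambda>s. s + m) ` (UNIV - S)"
    proof (cases "s \<le> m")
      case False
      then have "s = (s - m) + m" "s - m \<noteq> 0" by auto
      then have "s - m \<notin> S" using s m unfolding sg_atoms_def by blast
      then show ?thesis using \<open>s = (s - m) + m\<close> by blast
    qed auto
  qed
  then show ?thesis
    using assms finite_subset
    by (fastforce simp: min_gens_eq_atoms numerical_semigroup_def)
qed

section \<open>The defining ideal\<close>

text \<open>
  A monomial with exponent vector \<open>a\<close> is a finitely supported function \<open>a :: nat \<Rightarrow>\<^sub>0 nat\<close>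
  and \<open>keys a\<close> is its support; a polynomial is a finitely supported function from
  exponent vectors to coefficients, with the convolution product.
  The type has infinitely many variables, so the ring in \<open>x\<^sub>1, \<dots>, x\<^sub>e\<close> is cut out by its carrier.
\<close>

type_synonym 'k mpolynomial = "(nat \<Rightarrow>\<^sub>0 nat) \<Rightarrow>\<^sub>0 'k"

definition polynomial_ring :: "nat \<Rightarrow> ('k :: field) mpolynomial ring" where
  "polynomial_ring e =
     ring_of_type_algebra \<lparr>carrier := {p. \<forall>a\<in>Poly_Mapping.keys p. Poly_Mapping.keys a \<subseteq> {1..e}}\<rparr>"

lemma cring_polynomial_ring: "cring (polynomial_ring e :: ('k::field) mpolynomial ring)"
proof -
  define C where "C = {p :: 'k mpolynomial. \<forall>a\<in>Poly_Mapping.keys p. Poly_Mapping.keys a \<subseteq> {1..e}}"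
  have m: "p * q \<in> C" if "p \<in> C" "q \<in> C" for p q
  proof -
    have "Poly_Mapping.keys a \<subseteq> {1..e}" if a: "a \<in> Poly_Mapping.keys (p*q)" for a
    proof -
      obtain b c where "b \<in> Poly_Mapping.keys p" "c \<in> Poly_Mapping.keys q" "a = b + c"
        using keys_mult[of p q] a by blast
      then show ?thesis using \<open>p \<in> C\<close> \<open>q \<in> C\<close> Poly_Mapping.keys_add[of b c] unfolding C_def by blast
    qed
    then show ?thesis by (simp add: C_def)
  qed
  have ad: "p + q \<in> C" if "p \<in> C" "q \<in> C" for p q
    using that Poly_Mapping.keys_add[of p q] unfolding C_def by blast
  have z: "0 \<in> C" "1 \<in> C" by (auto simp: C_def)
  have u: "- p \<in> C" if "p \<in> C" for p using that by (simp add: C_def Poly_Mapping.keys.rep_eq)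
  have eq: "polynomial_ring e = \<lparr>carrier = C, monoid.mult = (*), one = 1, ring.zero = 0, add = (+)\<rparr>"
    by (simp add: polynomial_ring_def ring_of_type_algebra_def C_def)
  show ?thesis unfolding eq
  proof (rule cringI, goal_cases)
    case 1 show ?case
      apply (rule abelian_groupI)
      using ad z u by (auto simp: algebra_simps intro!: bexI[of _ "- _"])
  next
    case 2 show ?case
      apply (rule comm_monoidI)
      using m z by (auto simp: algebra_simps)
  qed (simp add: algebra_simps)
qed

text \<open>The subalgebra of \<open>k[t]\<close> spanned by the powers \<open>t\<^sup>s\<close> with \<open>s \<in> S\<close>.\<close>

definition semigroup_ring :: "nat set \<Rightarrow> ('k :: field) Polynomial.poly ring" where
  "semigroup_ring S =
     ring_of_type_algebra
       \<lparr>carrier := {f. \<forall>s. Polynomial.coeff f s \<noteq> 0 \<longrightarrow> s \<in> S}\<rparr>"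

text \<open>The evaluation \<open>x\<^sub>i \<mapsto> t\<^bsup>n\<^sub>i\<^esup>\<close>.\<close>

definition param_map :: "nat set \<Rightarrow> ('k :: field) mpolynomial \<Rightarrow> 'k Polynomial.poly" where
  "param_map S p =
     (\<Sum>a\<in>Poly_Mapping.keys p. Polynomial.smult (Poly_Mapping.lookup p a)
        (\<Prod>i\<in>{1..embdim S}. Polynomial.monom 1 (mingen S i) ^ Poly_Mapping.lookup a i))"

definition defining_ideal :: "nat set \<Rightarrow> ('k :: field) mpolynomial set" where
  "defining_ideal S =
     a_kernel (polynomial_ring (embdim S)) (semigroup_ring S) (param_map S)"

section \<open>Genericity\<close>

definition monomial :: "(nat \<Rightarrow>\<^sub>0 nat) \<Rightarrow> ('k :: field) mpolynomial" where
  "monomial a = Poly_Mapping.single a 1"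

definition full_support_binomial :: "nat \<Rightarrow> ('k :: field) mpolynomial \<Rightarrow> bool" where
  "full_support_binomial e f \<longleftrightarrow>
     (\<exists>a b. f = monomial a - monomial b \<and> Poly_Mapping.keys a \<union> Poly_Mapping.keys b = {1..e})"

definition minimal_ideal_generators :: "('a, 'm) ring_scheme \<Rightarrow> 'a set \<Rightarrow> 'a set \<Rightarrow> bool" where
  "minimal_ideal_generators R I F \<longleftrightarrow>
     F \<subseteq> carrier R \<and> genideal R F = I \<and> (\<forall>G. G \<subset> F \<longrightarrow> genideal R G \<noteq> I)"

definition generic_ideal :: "nat \<Rightarrow> ('k :: field) mpolynomial set \<Rightarrow> bool" where
  "generic_ideal e I \<longleftrightarrow>
     (\<exists>F. minimal_ideal_generators (polynomial_ring e) I F \<and>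
          (\<forall>f\<in>F. full_support_binomial e f))"

end

theory Submission
  imports Defs
begin

text \<open>
  Two facts about an Arf semigroup \<open>S\<close> with multiplicity \<open>m \<ge> 4\<close> contradict each other if the
  ideal is generic. Write \<open>n\<^sub>1 < \<dots> < n\<^sub>e\<close> for the minimal generators.

  The Arf property makes the smallest nonzero element of \<open>S\<close> in each residue class modulo \<open>m\<close> an
  atom, hence \<open>e \<ge> m \<ge> 4\<close> (\<open>multiplicity_le_embdim\<close>). It also gives \<open>2 n\<^sub>2 - n\<^sub>1 \<in> S\<close>, so some
  binomial \<open>x\<^sub>2\<^sup>2 - x\<^sub>1 x\<^sup>c\<close> lies in \<open>I\<^sub>S\<close>.

  The polynomials without the monomials \<open>1, x\<^sub>2, x\<^sub>2\<^sup>2\<close> form an ideal, because these three are all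
  the divisors of \<open>x\<^sub>2\<^sup>2\<close>. As \<open>I\<^sub>S\<close> is not inside that ideal, every generating system contains a
  polynomial in which one of the three occurs (\<open>generator_meets_divisor_closed_set\<close>). If this
  polynomial is a binomial \<open>x\<^sub>2\<^sup>k - x\<^sup>b\<close> of full support with \<open>k \<le> 2\<close>, then all variables other
  than \<open>x\<^sub>2\<close> divide \<open>x\<^sup>b\<close>, and since the binomial vanishes on the monomial curve,
  \<open>2 n\<^sub>2 \<ge> k n\<^sub>2 \<ge> n\<^sub>1 + n\<^sub>3 + n\<^sub>4 > 2 n\<^sub>2\<close>, which is absurd.
\<close>

section \<open>Minimal generators of Arf semigroups\<close>

lemma sg_multiplicity_in:
  assumes "numerical_semigroup S"
  shows "sg_multiplicity S \<in> S \<and> sg_multiplicity S \<noteq> 0"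
proof -
  have "infinite S"
    using assms finite_Diff2[of S UNIV] by (auto simp: numerical_semigroup_def)
  then obtain s where "s \<in> S \<and> s \<noteq> 0"
    by (metis finite.emptyI finite_insert insertI1 subsetI finite_subset)
  then show ?thesis unfolding sg_multiplicity_def by (rule LeastI)
qed

lemma sg_multiplicity_le: "s \<in> S \<Longrightarrow> s \<noteq> 0 \<Longrightarrow> sg_multiplicity S \<le> s"
  unfolding sg_multiplicity_def by (rule Least_le) simp

lemma numerical_semigroup_meets_residue_class:
  assumes "numerical_semigroup S" "0 < m"
  shows "\<exists>s\<in>S. s \<noteq> 0 \<and> s mod m = r mod m"
proof -
  have "infinite (range (\<lambda>k. r + Suc k * m))"
    using assms(2) by (intro range_inj_infinite injI) simp
  moreover have "finite (UNIV - S)"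
    using assms(1) by (simp add: numerical_semigroup_def)
  ultimately have "\<not> range (\<lambda>k. r + Suc k * m) \<subseteq> UNIV - S"
    using finite_subset by blast
  then obtain k where "r + Suc k * m \<in> S" by blast
  moreover have "r + Suc k * m \<noteq> 0" using assms(2) by simp
  ultimately show ?thesis by (metis mod_mult_self1)
qed

text \<open>
  A sum \<open>a + b\<close> of nonzero elements can be lowered by the multiplicity \<open>m\<close> without leaving \<open>S\<close>, by
  the Arf property applied to \<open>m \<le> a \<le> b\<close>. So the least nonzero element of \<open>S\<close> in a residue
  class modulo \<open>m\<close> is never such a sum, which yields \<open>m\<close> different atoms.
\<close>

lemma multiplicity_le_embdim:
  assumes S: "numerical_semigroup S" and arf: "arf S"
  shows "sg_multiplicity S \<le> embdim S"
proof -
  define m where "m = sg_multiplicity S"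
  define w where "w r = (LEAST s. s \<in> S \<and> s \<noteq> 0 \<and> s mod m = r mod m)" for r
  have m: "m \<in> S" "0 < m"
    using sg_multiplicity_in[OF S] by (auto simp: m_def)
  have w: "w r \<in> S" "w r \<noteq> 0" "w r mod m = r mod m" for r
    using numerical_semigroup_meets_residue_class[OF S m(2), of r]
      LeastI_ex[of "\<lambda>s. s \<in> S \<and> s \<noteq> 0 \<and> s mod m = r mod m"] unfolding w_def by blast+
  have w_le: "w r \<le> s" if "s \<in> S" "s \<noteq> 0" "s mod m = r mod m" for r s
    unfolding w_def by (rule Least_le) (use that in simp)
  have "w r \<in> sg_atoms S" for r
  proof -
    have False if ab: "a \<in> S" "b \<in> S" "a \<noteq> 0" "b \<noteq> 0" "w r = a + b" for a b
    proof -
      have ge: "m \<le> a" "m \<le> b"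
        using ab sg_multiplicity_le[of _ S] by (auto simp: m_def)
      have "a + b - m \<in> S"
      proof (cases "a \<le> b")
        case True
        then show ?thesis using arf m(1) ab(1,2) ge(1) unfolding arf_def by blast
      next
        case False
        then have "b + a - m \<in> S" using arf m(1) ab(1,2) ge(2) unfolding arf_def
          by (meson nle_le)
        then show ?thesis by (simp add: add.commute)
      qed
      moreover have "a + b - m \<noteq> 0" "(a + b - m) mod m = r mod m"
        using ge m(2) w(3)[of r] ab(5) le_mod_geq[of m "a + b"] by simp_all
      ultimately have "w r \<le> a + b - m" by (rule w_le)
      then show False using ab(5) ge m(2) by linarith
    qed
    then show ?thesis using w(1,2)[of r] unfolding sg_atoms_def by blast
  qed
  then have "w ` {..<m} \<subseteq> min_gens S"
    using min_gens_eq_atoms[OF S] by blast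
  moreover have "inj_on w {..<m}"
    by (rule inj_onI) (metis lessThan_iff mod_less w(3))
  ultimately have "card {..<m} \<le> card (min_gens S)"
    using finite_min_gens[OF S] by (metis card_inj_on_le)
  then show ?thesis by (simp add: embdim_def m_def)
qed

lemma mingen_strict_mono:
  assumes "1 \<le> i" "i < j" "j \<le> embdim S"
  shows "mingen S i < mingen S j"
  using assms sorted_wrt_nth_less[OF strict_sorted_list_of_set, of "i - 1" "j - 1" "min_gens S"]
  by (simp add: mingen_def embdim_def)

lemma mingen_image:
  assumes "numerical_semigroup S"
  shows "mingen S ` {1..embdim S} = min_gens S"
proof -
  let ?xs = "sorted_list_of_set (min_gens S)"
  have "mingen S ` {1..embdim S} = (\<lambda>k. ?xs ! k) ` {..<length ?xs}"
  proof -
    have "{1..embdim S} = Suc ` {..<length ?xs}"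
      by (simp add: embdim_def image_Suc_lessThan)
    then show ?thesis by (simp add: mingen_def image_image)
  qed
  also have "\<dots> = set ?xs" by (auto simp: set_conv_nth)
  finally show ?thesis using finite_min_gens[OF assms] by simp
qed

section \<open>Binomials in the defining ideal\<close>

text \<open>The exponent of \<open>t\<close> in the image of the monomial \<open>x\<^sup>a\<close> under \<open>x\<^sub>i \<mapsto> t\<^bsup>n\<^sub>i\<^esup>\<close>.\<close>

definition sdegree :: "nat set \<Rightarrow> (nat \<Rightarrow>\<^sub>0 nat) \<Rightarrow> nat" where
  "sdegree S a = (\<Sum>i\<in>{1..embdim S}. Poly_Mapping.lookup a i * mingen S i)"

lemma sdegree_add: "sdegree S (a + b) = sdegree S a + sdegree S b"
  by (simp add: sdegree_def lookup_add sum.distrib algebra_simps)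

lemma sdegree_single:
  assumes "i \<in> {1..embdim S}"
  shows "sdegree S (Poly_Mapping.single i k) = k * mingen S i"
proof -
  have "sdegree S (Poly_Mapping.single i k)
      = (\<Sum>j\<in>{1..embdim S}. if i = j then k * mingen S j else 0)"
    unfolding sdegree_def by (intro sum.cong) (auto simp: lookup_single when_def)
  also have "\<dots> = k * mingen S i" using assms by simp
  finally show ?thesis .
qed

lemma sdegree_surj:
  assumes S: "numerical_semigroup S" and "s \<in> S"
  shows "\<exists>c. Poly_Mapping.keys c \<subseteq> {1..embdim S} \<and> sdegree S c = s"
proof -
  have "s \<in> submonoid_gen (min_gens S)"
    using assms submonoid_gen_atoms[OF S] min_gens_eq_atoms[OF S] by simp
  then show ?thesis
  proof induction
    case zero
    then show ?case by (intro exI[of _ 0]) (simp add: sdegree_def)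
  next
    case (gen a)
    then obtain i where "i \<in> {1..embdim S}" "a = mingen S i"
      using mingen_image[OF S] by blast
    then show ?case
      by (intro exI[of _ "Poly_Mapping.single i 1"]) (simp add: sdegree_single)
  next
    case (add a b)
    then obtain c d where "Poly_Mapping.keys c \<subseteq> {1..embdim S}" "sdegree S c = a"
      "Poly_Mapping.keys d \<subseteq> {1..embdim S}" "sdegree S d = b" by blast
    then show ?case
      using Poly_Mapping.keys_add[of c d] by (intro exI[of _ "c + d"]) (auto simp: sdegree_add)
  qed
qed

lemma param_map_binomial:
  assumes "a \<noteq> b"
  shows "param_map S (monomial a - monomial b :: 'k::field mpolynomial)
       = Polynomial.monom 1 (sdegree S a) - Polynomial.monom 1 (sdegree S b)"
proof -
  have prod: "(\<Prod>i\<in>{1..embdim S}. Polynomial.monom (1::'k) (mingen S i) ^ Poly_Mapping.lookup c i)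
      = Polynomial.monom 1 (sdegree S c)" for c
  proof -
    have "(\<Prod>i\<in>A. Polynomial.monom (1::'k) (mingen S i) ^ Poly_Mapping.lookup c i)
        = Polynomial.monom 1 (\<Sum>i\<in>A. Poly_Mapping.lookup c i * mingen S i)"
      if "finite A" for A
      using that by induction (simp_all add: monom_power mult_monom mult.commute)
    then show ?thesis by (simp add: sdegree_def)
  qed
  have look: "Poly_Mapping.lookup (monomial a - monomial b :: 'k mpolynomial) c
      = (if c = a then 1 else if c = b then - 1 else 0)" for c
    using assms by (auto simp: monomial_def lookup_minus lookup_single when_def)
  then have "Poly_Mapping.keys (monomial a - monomial b :: 'k mpolynomial) = {a, b}"
    by (auto simp: in_keys_iff split: if_splits)
  then show ?thesis
    using assms unfolding param_map_def prod by (simp add: look)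
qed

lemma carrier_polynomial_ring:
  "carrier (polynomial_ring e) = {p. \<forall>a\<in>Poly_Mapping.keys p. Poly_Mapping.keys a \<subseteq> {1..e}}"
  by (simp add: polynomial_ring_def ring_of_type_algebra_def)

lemma polynomial_ring_ops:
  "\<zero>\<^bsub>polynomial_ring e\<^esub> = 0" "p \<oplus>\<^bsub>polynomial_ring e\<^esub> q = p + q" "p \<otimes>\<^bsub>polynomial_ring e\<^esub> q = p * q"
  by (simp_all add: polynomial_ring_def ring_of_type_algebra_def)

lemma mem_defining_ideal:
  "p \<in> defining_ideal S \<longleftrightarrow> p \<in> carrier (polynomial_ring (embdim S)) \<and> param_map S p = 0"
  by (auto simp: defining_ideal_def a_kernel_def' semigroup_ring_def ring_of_type_algebra_def)

lemma binomial_in_defining_ideal_iff: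
  assumes "a \<noteq> b" "Poly_Mapping.keys a \<subseteq> {1..embdim S}" "Poly_Mapping.keys b \<subseteq> {1..embdim S}"
  shows "(monomial a - monomial b :: 'k::field mpolynomial) \<in> defining_ideal S
     \<longleftrightarrow> sdegree S a = sdegree S b"
proof -
  have "Poly_Mapping.keys (monomial a - monomial b :: 'k mpolynomial) \<subseteq> {a, b}"
    by (auto simp: in_keys_iff monomial_def lookup_minus lookup_single when_def split: if_splits)
  then have "(monomial a - monomial b :: 'k mpolynomial) \<in> carrier (polynomial_ring (embdim S))"
    using assms(2,3) unfolding carrier_polynomial_ring by blast
  moreover have "Polynomial.monom (1::'k) i = Polynomial.monom 1 j \<longleftrightarrow> i = j" for i j
    by (metis degree_monom_eq one_neq_zero)
  ultimately show ?thesis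
    by (simp add: mem_defining_ideal param_map_binomial[OF assms(1)])
qed

section \<open>Monomials that every generating system must contain\<close>

text \<open>
  A monomial of \<open>p * q\<close> is a multiple of a monomial of \<open>p\<close>. Hence, if a set of monomials contains
  all divisors of its members, avoiding it is preserved by multiplication.
\<close>

lemma ideal_avoiding_divisor_closed_set:
  fixes D :: "(nat \<Rightarrow>\<^sub>0 nat) set" and e :: nat
  assumes D: "\<And>a b. a + b \<in> D \<Longrightarrow> a \<in> D"
  defines "R \<equiv> polynomial_ring e :: 'k::field mpolynomial ring"
  shows "ideal {p \<in> carrier R. Poly_Mapping.keys p \<inter> D = {}} R"
proof -
  let ?J = "{p \<in> carrier R. Poly_Mapping.keys p \<inter> D = {}}"
  interpret cring R unfolding R_def by (rule cring_polynomial_ring)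
  have mult: "p * q \<in> ?J" if p: "p \<in> ?J" and q: "q \<in> carrier R" for p q
  proof -
    have "p * q \<in> carrier R"
      using m_closed[of p q] p q by (simp add: R_def polynomial_ring_ops)
    moreover have "Poly_Mapping.keys (p * q) \<inter> D = {}"
      using keys_mult[of p q] p D by blast
    ultimately show ?thesis by simp
  qed
  have minus: "\<ominus>\<^bsub>R\<^esub> p = - p" if "p \<in> carrier R" for p
    using r_neg[OF that] by (simp add: R_def polynomial_ring_ops eq_neg_iff_add_eq_0 add.commute)
  have "additive_subgroup ?J R"
  proof (rule additive_subgroup.intro, rule add.subgroupI)
    show "?J \<noteq> {}"
      using zero_closed by (auto simp: R_def polynomial_ring_ops)
  next
    fix p assume "p \<in> ?J"
    then show "\<ominus>\<^bsub>R\<^esub> p \<in> ?J"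
      using a_inv_closed[of p] by (auto simp: minus Poly_Mapping.keys.rep_eq)
  next
    fix p q assume "p \<in> ?J" "q \<in> ?J"
    then show "p \<oplus>\<^bsub>R\<^esub> q \<in> ?J"
      using a_closed[of p q] Poly_Mapping.keys_add[of p q] by (auto simp: R_def polynomial_ring_ops)
  qed auto
  then show ?thesis
    by (intro ideal.intro ideal_axioms.intro ring_axioms)
      (use mult in \<open>auto simp: R_def polynomial_ring_ops mult.commute\<close>)
qed

lemma generator_meets_divisor_closed_set:
  fixes F :: "'k::field mpolynomial set"
  assumes D: "\<And>a b. a + b \<in> D \<Longrightarrow> a \<in> D"
    and F: "F \<subseteq> carrier (polynomial_ring e)"
    and p: "p \<in> genideal (polynomial_ring e) F" "Poly_Mapping.keys p \<inter> D \<noteq> {}"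
  shows "\<exists>f\<in>F. Poly_Mapping.keys f \<inter> D \<noteq> {}"
proof (rule ccontr)
  let ?R = "polynomial_ring e :: 'k mpolynomial ring"
  let ?J = "{p \<in> carrier ?R. Poly_Mapping.keys p \<inter> D = {}}"
  assume "\<not> ?thesis"
  then have "F \<subseteq> ?J" using F by blast
  moreover have "ideal ?J ?R" by (rule ideal_avoiding_divisor_closed_set) (rule D)
  ultimately have "genideal ?R F \<subseteq> ?J"
    by (intro ring.genideal_minimal cring.axioms(1) cring_polynomial_ring)
  then show False using p by blast
qed

section \<open>Arf semigroups are not generic\<close>

text \<open>
  A monomial divisible by all variables except \<open>x\<^sub>2\<close> has a degree too large to equal the degree of
  \<open>1\<close>, \<open>x\<^sub>2\<close> or \<open>x\<^sub>2\<^sup>2\<close>. This needs a fourth variable: \<open>n\<^sub>1 + n\<^sub>3\<close> alone may equal \<open>2 n\<^sub>2\<close>.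
\<close>

lemma sdegree_large_if_full_support_off_2:
  assumes e: "4 \<le> embdim S" and supp: "{1..embdim S} - {2} \<subseteq> Poly_Mapping.keys b"
  shows "2 * mingen S 2 < sdegree S b"
proof -
  have "mingen S 1 + mingen S 3 + mingen S 4 = (\<Sum>i\<in>{1,3,4}. mingen S i)" by simp
  also have "\<dots> \<le> (\<Sum>i\<in>{1,3,4}. Poly_Mapping.lookup b i * mingen S i)"
  proof (rule sum_mono)
    fix i :: nat assume "i \<in> {1,3,4}"
    then have "i \<in> Poly_Mapping.keys b" using e supp by auto
    then have "1 \<le> Poly_Mapping.lookup b i" by (simp add: in_keys_iff Suc_le_eq)
    then show "mingen S i \<le> Poly_Mapping.lookup b i * mingen S i"
      using mult_le_mono1[of 1] by fastforce
  qed
  also have "\<dots> \<le> sdegree S b"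
    unfolding sdegree_def by (rule sum_mono2) (use e in auto)
  finally show ?thesis
    using mingen_strict_mono[of 2 3 S] mingen_strict_mono[of 2 4 S] e by simp
qed

theorem theorem5p8:
  fixes S :: "nat set"
  assumes "numerical_semigroup S"
    and "arf S"
    and "sg_multiplicity S > 3"
  shows "\<not> generic_ideal (embdim S)
           (defining_ideal S :: ('k :: {alg_closed_field, field_char_0}) mpolynomial set)"
proof
  let ?e = "embdim S" and ?I = "defining_ideal S :: 'k mpolynomial set"
  assume "generic_ideal ?e ?I"
  then obtain F where "minimal_ideal_generators (polynomial_ring ?e) ?I F"
    and full: "\<And>f. f \<in> F \<Longrightarrow> full_support_binomial ?e f"
    unfolding generic_ideal_def by blast
  then have F: "F \<subseteq> carrier (polynomial_ring ?e)" "genideal (polynomial_ring ?e) F = ?I"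
    by (simp_all add: minimal_ideal_generators_def)
  have e: "4 \<le> ?e"
    using multiplicity_le_embdim[OF assms(1,2)] assms(3) by linarith
  define x22 where "x22 = Poly_Mapping.single (2::nat) (2::nat)"
  \<comment> \<open>the exponent vectors of the divisors \<open>1, x\<^sub>2, x\<^sub>2\<^sup>2\<close> of \<open>x\<^sub>2\<^sup>2\<close>\<close>
  define D where "D = {a. Poly_Mapping.keys a \<subseteq> {2::nat} \<and> Poly_Mapping.lookup a 2 \<le> (2::nat)}"
  have keys_add: "Poly_Mapping.keys (a + b) = Poly_Mapping.keys a \<union> Poly_Mapping.keys b"
    for a b :: "nat \<Rightarrow>\<^sub>0 nat"
    by (auto simp: in_keys_iff lookup_add)
  have D: "a \<in> D" if "a + b \<in> D" for a b
    using that unfolding D_def by (simp add: keys_add lookup_add)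

  obtain c where c: "Poly_Mapping.keys c \<subseteq> {1..?e}" "sdegree S c = 2 * mingen S 2 - mingen S 1"
  proof -
    have "mingen S i \<in> S" if "i \<in> {1..?e}" for i
      using that mingen_image[OF assms(1)] min_gens_eq_atoms[OF assms(1)]
      unfolding sg_atoms_def by blast
    then have "mingen S 1 \<in> S" "mingen S 2 \<in> S" using e by simp_all
    moreover have "mingen S 1 \<le> mingen S 2"
      using mingen_strict_mono[of 1 2 S] e by simp
    ultimately have "mingen S 2 + mingen S 2 - mingen S 1 \<in> S"
      using assms(2) unfolding arf_def by blast
    then show ?thesis using sdegree_surj[OF assms(1)] that by (metis mult_2)
  qed
  \<comment> \<open>the monomial \<open>x\<^sub>1 x\<^sup>c\<close>, of the same degree as \<open>x\<^sub>2\<^sup>2\<close>; only this one is divisible by \<open>x\<^sub>1\<close>\<close>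
  define x1c where "x1c = Poly_Mapping.single 1 1 + c"
  have keys: "Poly_Mapping.keys x22 \<subseteq> {1..?e}" "Poly_Mapping.keys x1c \<subseteq> {1..?e}"
    using c(1) e by (auto simp: x22_def x1c_def keys_add)
  have "Poly_Mapping.lookup x1c 1 \<noteq> Poly_Mapping.lookup x22 1"
    by (simp add: x1c_def x22_def lookup_add lookup_single)
  then have neq: "x22 \<noteq> x1c" by auto
  have "sdegree S x22 = sdegree S x1c"
    using c(2) mingen_strict_mono[of 1 2 S] e
    by (simp add: x22_def x1c_def sdegree_add sdegree_single)
  then have "(monomial x22 - monomial x1c :: 'k mpolynomial) \<in> ?I"
    by (simp add: binomial_in_defining_ideal_iff[OF neq keys])
  moreover have "x22 \<in> Poly_Mapping.keys (monomial x22 - monomial x1c :: 'k mpolynomial)"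
    using neq by (simp add: in_keys_iff monomial_def lookup_minus lookup_single when_def)
  moreover have "x22 \<in> D" by (simp add: D_def x22_def)
  ultimately have "\<exists>f\<in>F. Poly_Mapping.keys f \<inter> D \<noteq> {}"
    by (intro generator_meets_divisor_closed_set[of D F ?e "monomial x22 - monomial x1c"])
      (use D F in auto)
  then obtain f where f: "f \<in> F" "Poly_Mapping.keys f \<inter> D \<noteq> {}" by blast

  from full[OF f(1)] obtain a b where ab: "f = monomial a - monomial b"
      "Poly_Mapping.keys a \<union> Poly_Mapping.keys b = {1..?e}"
    unfolding full_support_binomial_def by blast
  have "a \<noteq> b" using f(2) ab(1) by auto
  have "f \<in> ?I"
    using ring.genideal_self[OF cring.axioms(1)[OF cring_polynomial_ring] F(1)] f(1) F(2) by auto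
  then have deg: "sdegree S a = sdegree S b"
    using binomial_in_defining_ideal_iff[OF \<open>a \<noteq> b\<close>] ab by blast
  have "a \<in> D \<or> b \<in> D"
    using f(2) ab(1)
    by (auto simp: in_keys_iff monomial_def lookup_minus lookup_single when_def split: if_splits)
  moreover have False
    if "u \<in> D" "Poly_Mapping.keys u \<union> Poly_Mapping.keys v = {1..?e}" "sdegree S u = sdegree S v"
    for u v
  proof -
    have "u = Poly_Mapping.single 2 (Poly_Mapping.lookup u 2)"
      using that(1) unfolding D_def
      by (intro poly_mapping_eqI) (auto simp: lookup_single when_def in_keys_iff)
    then have "sdegree S u = Poly_Mapping.lookup u 2 * mingen S 2"
      using sdegree_single[of 2 S "Poly_Mapping.lookup u 2"] e by simp
    also have "\<dots> \<le> 2 * mingen S 2" using that(1) by (simp add: D_def)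
    also have "\<dots> < sdegree S v"
      by (rule sdegree_large_if_full_support_off_2[OF e]) (use that(1,2) in \<open>auto simp: D_def\<close>)
    finally show False using that(3) by simp
  qed
  ultimately show False using ab(2) deg by (metis Un_commute)
qed

end
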